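(* Let $A$ be a finite-dimensional real alternative algebra with unity and a fixed antiinvolution $x\mapsto x^c$, with $\mathbb{S}_A\ne\emptyset$. Let $f=\mathcal{I}(F)$ be a slice function on $\Omega_D$. Let $x=\alpha+\beta J\in\Omega_D$ ($\alpha,\beta\in\mathbb{R}$, $J\in\mathbb{S}_A$) and $z=\alpha+i\beta\in D$. Assume that, if $x\notin\mathbb{R}$, then the spherical derivative $\partial_sf(x)$ belongs to $N_A$. Then one of the following mutually exclusive statements holds: (1) $\mathbb{S}_x\cap V(f)=\emptyset$. (2) $\mathbb{S}_x\subseteq V(f)$. In this case $x$ is called a real (if $x\in\mathbb{R}$) or spherical (if $x\notin\mathbb{R}$) zero of $f$. (3) $\mathbb{S}_x\cap V(f)$ consists of a single, non-real point. In this case $x$ is called an $\mathbb{S}_A$-isolated non-real zero of $f$. These three possibilities correspond, respectively, to the following properties of $F(z)\in A_{\mathbb{C}}$: (1') $CN(F)(z)=F(z)F(z)^c\neq0$. (2') $F(z)=0$. (3') $F(z)\neq0$ and $CN(F)(z)=0$ (in this case $F(z)$ is a zero-divisor of $A_{\mathbb{C}}$).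
   Context: Setting. $A$ is a finite-dimensional real alternative algebra with unity, of real dimension $d>1$ (alternative: the associator $(x,y,z)=(xy)z-x(yz)$ is alternating); $\mathbb{R}$ is identified with $\mathbb{R}\cdot 1\subseteq A$. An antiinvolution $x\mapsto x^c$ is fixed: a linear map with $(x^c)^c=x$, $(xy)^c=y^cx^c$, and $x^c=x$ for $x\in\mathbb{R}$. Put $t(x)=x+x^c$, $n(x)=xx^c$ (elements of $A$, not assumed real). Normal cone: $N_A=\{0\}\cup\{x\in A \mid n(x)=n(x^c)\text{ is a real nonzero number}\}$. Quadratic cone: $Q_A=\mathbb{R}\cup\{x\in A\mid t(x)\in\mathbb{R},\ n(x)\in\mathbb{R},\ 4n(x)>t(x)^2\}$. $\mathbb{S}_A=\{J\in Q_A\mid J^2=-1\}$, assumed non-empty. For $J\in\mathbb{S}_A$, $\mathbb{C}_J=\langle 1,J\rangle\simeq\mathbb{C}$; one has $Q_A=\bigcup_{J\in\mathbb{S}_A}\mathbb{C}_J$. For $x=\alpha+\beta J\in Q_A$, $\mathbb{S}_x=\{\alpha+\beta I\mid I\in\mathbb{S}_A\}$ and $\mathrm{Im}(x)=(x-x^c)/2=\beta J$. Slice functions. $A_{\mathbb{C}}=A\otimes_{\mathbb{R}}\mathbb{C}=\{x+iy\mid x,y\in A\}$ with product $(x+iy)(x'+iy')=xx'-yy'+i(xy'+yx')$, conjugation $\overline{x+iy}=x-iy$, and $(x+iy)^c=x^c+iy^c$. $D\subseteq\mathbb{C}$ is open and, without restriction, invariant under complex conjugation. A stem function on $D$ is $F=F_1+iF_2:D\to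 A_{\mathbb{C}}$ ($F_1,F_2$ $A$-valued) with $F(\bar z)=\overline{F(z)}$. Let $\Omega_D=\{\alpha+\beta J\mid \alpha,\beta\in\mathbb{R},\ \alpha+i\beta\in D,\ J\in\mathbb{S}_A\}\subseteq Q_A$. The slice function $f=\mathcal{I}(F):\Omega_D\to A$ induced by $F$ is $f(\alpha+\beta J)=F_1(\alpha+i\beta)+JF_2(\alpha+i\beta)$. Its spherical derivative at $x=\alpha+\beta J\in\Omega_D\setminus\mathbb{R}$ is $\partial_sf(x)=\frac12\mathrm{Im}(x)^{-1}(f(x)-f(x^c))=F_2(z)/\beta$, where $z=\alpha+i\beta$. $CN(F)(z)=F(z)F(z)^c$, and $V(f)$ is the zero set of $f$.
   Formalization: The correspondence of (1)-(3) with (1')-(3') is asserted except when x is real or the spherical derivative at x is 0, with f(x) ≠ 0 and n(f(x)) = 0; there (1) and (3') hold together, so the printed correspondence fails (e.g. F constantly E_12 in 2×2 real matrices with adjugate). *)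

theory Defs
  imports Complex_Main "HOL-Library.Product_Plus"
begin

section \<open>Real alternative algebras with antiinvolution\<close>

text \<open>The distribution's ring and algebra classes all assume associativity, so the
  product is introduced from scratch.\<close>

class real_nonassoc_algebra_1 = real_vector + times + one +
  assumes na_distrib_right: "(x + y) * z = x * z + y * z"
    and na_distrib_left: "x * (y + z) = x * y + x * z"
    and na_scaleR_left: "scaleR r x * y = scaleR r (x * y)"
    and na_scaleR_right: "x * scaleR r y = scaleR r (x * y)"
    and na_one_left: "1 * x = x"
    and na_one_right: "x * 1 = x"
begin

definition associator :: "'a \<Rightarrow> 'a \<Rightarrow> 'a \<Rightarrow> 'a" where
  "associator x y z = (x * y) * z - x * (y * z)"

end

text \<open>A trilinear map is alternating if it vanishes whenever two arguments coincide.\<close>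

class real_alternative_algebra = real_nonassoc_algebra_1 +
  assumes associator_alt_left: "associator x x y = 0"
    and associator_alt_right: "associator x y y = 0"
    and associator_alt_outer: "associator x y x = 0"

class real_alternative_star_algebra = real_alternative_algebra +
  fixes star :: "'a \<Rightarrow> 'a"  ("_\<^sup>c" [1000] 999)
  assumes star_add: "(x + y)\<^sup>c = x\<^sup>c + y\<^sup>c"
    and star_scaleR: "(scaleR r x)\<^sup>c = scaleR r (x\<^sup>c)"
    and star_star: "(x\<^sup>c)\<^sup>c = x"
    and star_mult: "(x * y)\<^sup>c = y\<^sup>c * x\<^sup>c"
    and star_real: "(scaleR r 1)\<^sup>c = scaleR r 1"

section \<open>Normal cone, quadratic cone, spheres\<close>

text \<open>\<^const>\<open>of_real\<close> and \<^const>\<open>Reals\<close> are only available for associative algebras.\<close>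

definition emb :: "real \<Rightarrow> 'a::real_nonassoc_algebra_1" where
  "emb r = r *\<^sub>R 1"

definition real_part_set :: "'a::real_nonassoc_algebra_1 set"  ("\<real>\<^sub>A") where
  "\<real>\<^sub>A = range emb"

definition trace_el :: "'a::real_alternative_star_algebra \<Rightarrow> 'a" where
  "trace_el x = x + x\<^sup>c"

definition norm_el :: "'a::real_alternative_star_algebra \<Rightarrow> 'a" where
  "norm_el x = x * x\<^sup>c"

definition normal_cone :: "'a::real_alternative_star_algebra set"  ("N\<^sub>A") where
  "N\<^sub>A = {0} \<union> {x. norm_el x = norm_el (x\<^sup>c) \<and> norm_el x \<in> \<real>\<^sub>A \<and> norm_el x \<noteq> 0}"

definition quadratic_cone :: "'a::real_alternative_star_algebra set"  ("Q\<^sub>A") where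
  "Q\<^sub>A = \<real>\<^sub>A \<union> {x. \<exists>t n. trace_el x = emb t \<and> norm_el x = emb n \<and> 4 * n > t\<^sup>2}"

definition imag_units :: "'a::real_alternative_star_algebra set"  ("\<S>\<^sub>A") where
  "\<S>\<^sub>A = {J \<in> Q\<^sub>A. J * J = - 1}"

text \<open>The sphere of \<open>x = \<alpha> + \<beta> J\<close>; the only other decomposition of a given non-real \<open>x\<close> is
  \<open>\<alpha> + (- \<beta>) (- J)\<close>, which yields the same set.\<close>

definition sphere_of :: "'a::real_alternative_star_algebra \<Rightarrow> 'a set"  ("\<S>\<^bsub>_\<^esub>") where
  "\<S>\<^bsub>x\<^esub> = {emb \<alpha> + \<beta> *\<^sub>R I | \<alpha> \<beta> I. I \<in> \<S>\<^sub>A \<and> (\<exists>J \<in> \<S>\<^sub>A. x = emb \<alpha> + \<beta> *\<^sub>R J)}"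

definition im_part :: "'a::real_alternative_star_algebra \<Rightarrow> 'a" where
  "im_part x = (1 / 2) *\<^sub>R (x - x\<^sup>c)"

definition alg_inverse :: "'a::real_alternative_algebra \<Rightarrow> 'a" where
  "alg_inverse a = (THE b. a * b = 1 \<and> b * a = 1)"

section \<open>The complexified algebra\<close>

text \<open>The pair \<open>(x, y)\<close> represents \<open>x + i y\<close>.\<close>

type_synonym 'a complexified = "'a \<times> 'a"

definition cmul :: "'a::real_alternative_star_algebra complexified \<Rightarrow> 'a complexified \<Rightarrow> 'a complexified"
    (infixl "*\<^sub>C" 70) where
  "v *\<^sub>C w = (fst v * fst w - snd v * snd w, fst v * snd w + snd v * fst w)"

definition cbar :: "'a::real_alternative_star_algebra complexified \<Rightarrow> 'a complexified" where
  "cbar w = (fst w, - snd w)"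

definition cstar :: "'a::real_alternative_star_algebra complexified \<Rightarrow> 'a complexified" where
  "cstar w = ((fst w)\<^sup>c, (snd w)\<^sup>c)"

definition zero_divisor :: "'a::real_alternative_star_algebra complexified \<Rightarrow> bool" where
  "zero_divisor w \<longleftrightarrow> w \<noteq> 0 \<and> (\<exists>v. v \<noteq> 0 \<and> (w *\<^sub>C v = 0 \<or> v *\<^sub>C w = 0))"

section \<open>Stem functions and slice functions\<close>

definition stem_function :: "complex set \<Rightarrow> (complex \<Rightarrow> 'a::real_alternative_star_algebra complexified) \<Rightarrow> bool" where
  "stem_function D F \<longleftrightarrow> (\<forall>z\<in>D. F (cnj z) = cbar (F z))"

definition slice_domain :: "complex set \<Rightarrow> 'a::real_alternative_star_algebra set"  ("\<Omega>\<^bsub>_\<^esub>") where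
  "\<Omega>\<^bsub>D\<^esub> = {emb \<alpha> + \<beta> *\<^sub>R J | \<alpha> \<beta> J. Complex \<alpha> \<beta> \<in> D \<and> J \<in> \<S>\<^sub>A}"

text \<open>\<open>f = \<I>(F)\<close> on \<open>\<Omega>\<^bsub>D\<^esub>\<close>; as usual for partial functions, \<open>f\<close> is total and its values
  outside \<open>\<Omega>\<^bsub>D\<^esub>\<close> are left arbitrary.\<close>

definition induced_slice_function ::
    "complex set \<Rightarrow> (complex \<Rightarrow> 'a::real_alternative_star_algebra complexified) \<Rightarrow> ('a \<Rightarrow> 'a) \<Rightarrow> bool" where
  "induced_slice_function D F f \<longleftrightarrow>
     (\<forall>\<alpha> \<beta>. \<forall>J\<in>\<S>\<^sub>A. Complex \<alpha> \<beta> \<in> D \<longrightarrow>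
        f (emb \<alpha> + \<beta> *\<^sub>R J) = fst (F (Complex \<alpha> \<beta>)) + J * snd (F (Complex \<alpha> \<beta>)))"

definition zero_set :: "complex set \<Rightarrow> ('a::real_alternative_star_algebra \<Rightarrow> 'a) \<Rightarrow> 'a set" where
  "zero_set D f = {x \<in> \<Omega>\<^bsub>D\<^esub>. f x = 0}"

definition spherical_derivative :: "('a::real_alternative_star_algebra \<Rightarrow> 'a) \<Rightarrow> 'a \<Rightarrow> 'a"  ("\<partial>\<^sub>s") where
  "\<partial>\<^sub>s f x = (1 / 2) *\<^sub>R (alg_inverse (im_part x) * (f x - f (x\<^sup>c)))"

definition CN :: "(complex \<Rightarrow> 'a::real_alternative_star_algebra complexified) \<Rightarrow> complex \<Rightarrow> 'a complexified" where
  "CN F z = F z *\<^sub>C cstar (F z)"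

text \<open>
  For \<open>x = \<alpha> + \<beta> J\<close> and \<open>z = \<alpha> + i \<beta>\<close>, the first disjunct says \<open>F\<^sub>2(z) = 0\<close>; then \<open>f\<close> is constant
  on \<open>\<S>\<^bsub>x\<^esub>\<close> with value \<open>F(z)\<close>, and \<open>CN(F)(z)\<close> is \<open>norm_el (f x)\<close>. If \<open>norm_el\<close> is isotropic
  (for instance on real \<open>2 \<times> 2\<close> matrices with the adjugate), \<open>CN(F)(z)\<close> can vanish although the
  constant value is non-zero, so that \<open>CN(F)(z)\<close> does not detect the absence of zeros.
\<close>

definition isotropic_constant_at :: "('a::real_alternative_star_algebra \<Rightarrow> 'a) \<Rightarrow> 'a \<Rightarrow> bool" where
  "isotropic_constant_at f x \<longleftrightarrow> (x \<in> \<real>\<^sub>A \<or> \<partial>\<^sub>s f x = 0) \<and> f x \<noteq> 0 \<and> norm_el (f x) = 0"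

end

theory Submission
  imports Defs
begin

text \<open>
  Write \<open>F(z) = (a, b)\<close>, so that \<open>f\<close> takes the value \<open>a + I b\<close> at \<open>\<alpha> + \<beta> I\<close>, and \<open>\<partial>\<^sub>s f x = b / \<beta>\<close>.
  If \<open>b = 0\<close>, then \<open>f\<close> is constant on the sphere. Otherwise \<open>b b\<^sup>c = b\<^sup>c b = r\<close> is a non-zero real,
  and the Moufang identities show that \<open>b\<close> can be cancelled. The only candidate for a zero is then
  given by \<open>I = - (a b\<^sup>c) / r\<close>. The second component of \<open>CN(F)(z)\<close> vanishes iff \<open>I\<^sup>c = - I\<close>, and the
  middle Moufang identity gives \<open>n(I b) = r n(I)\<close>, so that the first component vanishes iff
  \<open>I\<^sup>2 = - 1\<close>.
\<close>

section \<open>Alternative algebras\<close>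

lemma na_mult_zero [simp]:
  fixes x :: "'a::real_nonassoc_algebra_1"
  shows "0 * x = 0" "x * 0 = 0"
  using na_scaleR_left[of 0 x x] na_scaleR_right[of x 0 x] by simp_all

lemma na_mult_minus:
  fixes x :: "'a::real_nonassoc_algebra_1"
  shows "(- x) * y = - (x * y)" "x * (- y) = - (x * y)"
  using na_scaleR_left[of "-1" x y] na_scaleR_right[of x "-1" y] by simp_all

lemma na_mult_diff:
  fixes x :: "'a::real_nonassoc_algebra_1"
  shows "(x - y) * z = x * z - y * z" "x * (y - z) = x * y - x * z"
  by (simp_all only: diff_conv_add_uminus na_distrib_left na_distrib_right na_mult_minus)

lemmas na_simps = na_distrib_left na_distrib_right na_mult_diff na_mult_minus
  na_scaleR_left na_scaleR_right na_one_left na_one_right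

lemma associator_swap_left:
  fixes x :: "'a::real_alternative_algebra"
  shows "associator y x z = - associator x y z"
proof -
  have "associator (x + y) (x + y) z
      = associator x x z + associator y y z + (associator x y z + associator y x z)"
    by (simp add: associator_def na_simps algebra_simps)
  then show ?thesis
    by (simp add: associator_alt_left eq_neg_iff_add_eq_0 add.commute)
qed

lemma associator_swap_right:
  fixes x :: "'a::real_alternative_algebra"
  shows "associator x z y = - associator x y z"
proof -
  have "associator x (y + z) (y + z)
      = associator x y y + associator x z z + (associator x y z + associator x z y)"
    by (simp add: associator_def na_simps algebra_simps)
  then show ?thesis
    by (simp add: associator_alt_right eq_neg_iff_add_eq_0 add.commute)
qed

lemma left_alternative:
  fixes x :: "'a::real_alternative_algebra"
  shows "x * (x * y) = (x * x) * y"
  using associator_alt_left[of x y] by (simp add: associator_def)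

lemma right_alternative:
  fixes x :: "'a::real_alternative_algebra"
  shows "(x * y) * y = x * (y * y)"
  using associator_alt_right[of x y] by (simp add: associator_def)

lemma flexible:
  fixes x :: "'a::real_alternative_algebra"
  shows "(x * y) * x = x * (y * x)"
  using associator_alt_outer[of x y] by (simp add: associator_def)

section \<open>Moufang identities\<close>

text \<open>After the swaps both associators have last argument \<open>x\<close> and a middle
  argument ending in \<open>x\<close>, so right alternativity merges these factors into
  \<open>x * x\<close>. What remains is two associators that differ by exchanging \<open>y\<close>
  and \<open>a\<close>, and these cancel.\<close>

lemma right_moufang:
  fixes x :: "'a::real_alternative_algebra"
  shows "((y * x) * a) * x = y * ((x * a) * x)"
proof -
  have "((y * x) * a) * x - y * (x * (a * x))
      = associator y x (a * x) + associator (y * x) a x"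
    by (simp add: associator_def)
  also have "\<dots> = - associator y (a * x) x - associator a (y * x) x"
    by (simp only: associator_swap_right[of y x] associator_swap_left[of a "y * x"]) simp
  also have "\<dots> = y * (a * (x * x)) + a * (y * (x * x)) - (y * (a * x) + a * (y * x)) * x"
    by (simp add: associator_def right_alternative na_simps)
  \<comment> \<open>This regrouping is the linearized left alternative law.\<close>
  also have "y * (a * x) + a * (y * x) = (y * a) * x + (a * y) * x"
    using associator_swap_left[of y a x] by (simp add: associator_def algebra_simps)
  also have "y * (a * (x * x)) + a * (y * (x * x)) - ((y * a) * x + (a * y) * x) * x
      = - associator y a (x * x) - associator a y (x * x)"
    by (simp add: associator_def na_simps right_alternative)
  also have "\<dots> = 0"
    by (simp add: associator_swap_left[of y a])
  finally show ?thesis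
    by (simp add: flexible)
qed

text \<open>By right Moufang the error of the first regrouping,
  \<open>associator (x * a) b x\<close>, equals \<open>associator b x a * x\<close>. Cyclic symmetry
  turns this into \<open>associator x a b * x\<close>, exactly the excess of
  \<open>((x * a) * b) * x\<close> over the right-hand side.\<close>

lemma middle_moufang:
  fixes x :: "'a::real_alternative_algebra"
  shows "(x * a) * (b * x) = (x * (a * b)) * x"
proof -
  have "(x * a) * (b * x) = ((x * a) * b) * x - associator (x * a) b x"
    by (simp add: associator_def)
  also have "associator (x * a) b x = - associator b (x * a) x"
    by (rule associator_swap_left)
  also have "\<dots> = associator b x a * x"
    by (simp add: associator_def na_simps right_moufang)
  also have "associator b x a = associator x a b"
    by (simp add: associator_swap_left[of b x] associator_swap_right[of x a])
  finally show ?thesis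
    by (simp add: associator_def na_simps)
qed

text \<open>The square of \<open>c\<close> is what makes right multiplication by \<open>b\<close> injective: the right Moufang
  identity with \<open>c\<close> itself only yields \<open>R\<^sub>b R\<^sub>c R\<^sub>b = R\<^sub>b\<close>.\<close>

lemma right_mult_cancel:
  fixes b :: "'a::real_alternative_algebra"
  assumes "b * c = 1" "c * b = 1" and "y * b = 0"
  shows "y = 0"
proof -
  have "b * (c * c) = c"
    using assms(1) by (simp add: right_alternative[symmetric] na_one_left)
  then have "((y * b) * (c * c)) * b = y"
    using assms(2) by (simp add: right_moufang na_one_right)
  then show ?thesis
    using assms(3) by simp
qed

text \<open>Right Moufang gives \<open>((x * b) * c) * b = x * ((b * c) * b) = x * b\<close>, and
  the last \<open>b\<close> can be cancelled.\<close>

lemma mult_mult_right_inverse: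
  fixes b :: "'a::real_alternative_algebra"
  assumes "b * c = 1" "c * b = 1"
  shows "(x * b) * c = x"
proof -
  have "((x * b) * c - x) * b = 0"
    by (simp add: na_simps right_moufang assms)
  then show ?thesis
    using right_mult_cancel[OF assms] by fastforce
qed

text \<open>Replaces associativity below, for \<open>b\<close> and \<open>b\<^sup>c\<close> in
  either order: \<open>c\<close> divided by \<open>r\<close> is a two-sided inverse of
  \<open>b\<close>.\<close>

lemma mult_mult_emb:
  fixes b :: "'a::real_alternative_algebra"
  assumes "b * c = emb r" "c * b = emb r" "r \<noteq> 0"
  shows "(x * b) * c = r *\<^sub>R x"
proof -
  have "(x * b) * ((1 / r) *\<^sub>R c) = x"
    by (rule mult_mult_right_inverse) (use assms in \<open>simp_all add: na_simps emb_def\<close>)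
  then have "r *\<^sub>R ((1 / r) *\<^sub>R ((x * b) * c)) = r *\<^sub>R x"
    by (simp only: na_simps)
  then show ?thesis
    using assms(3) by simp
qed

text \<open>Evaluates the \<open>THE\<close>; uniqueness comes from right cancellation instead of
  associativity.\<close>

lemma alg_inverse_eq:
  fixes a :: "'a::real_alternative_algebra"
  assumes "a * b = 1" "b * a = 1"
  shows "alg_inverse a = b"
  unfolding alg_inverse_def
proof (rule the_equality)
  fix c assume c: "a * c = 1 \<and> c * a = 1"
  then have "(c - b) * a = 0"
    using assms by (simp add: na_simps)
  then show "c = b"
    using right_mult_cancel[OF assms] by fastforce
qed (use assms in simp)

section \<open>Imaginary units and spheres\<close>

lemma star_zero [simp]: "(0::'a::real_alternative_star_algebra)\<^sup>c = 0"
  using star_scaleR[of 0 "0::'a"] by simp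

lemma star_minus: "(- x::'a::real_alternative_star_algebra)\<^sup>c = - x\<^sup>c"
  using star_scaleR[of "-1" x] by simp

lemma star_eq_0_iff [simp]: "(x::'a::real_alternative_star_algebra)\<^sup>c = 0 \<longleftrightarrow> x = 0"
  by (metis star_star star_zero)

lemma star_emb [simp]: "(emb r::'a::real_alternative_star_algebra)\<^sup>c = emb r"
  by (simp add: emb_def star_real)

lemma emb_in_reals [simp]: "emb r \<in> \<real>\<^sub>A"
  by (simp add: real_part_set_def)

text \<open>In the zero algebra \<open>{0}\<close> spans, and its cardinality already bounds the
  dimension by 1.\<close>

lemma one_neq_zero:
  assumes "dim (UNIV :: 'a::real_nonassoc_algebra_1 set) > 1"
  shows "(1::'a) \<noteq> 0"
proof
  assume "(1::'a) = 0"
  then have "x = 0" for x :: 'a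
    by (metis na_mult_zero(1) na_one_left)
  then have "(UNIV :: 'a set) = {0}"
    by auto
  then have "UNIV \<subseteq> span {0::'a}"
    using span_superset[of "{0::'a}"] by simp
  then have "dim (UNIV :: 'a set) \<le> card {0::'a}"
    by (rule dim_le_card) simp
  then show False
    using assms by simp
qed

lemma imag_unit_not_real:
  assumes "(1::'a::real_alternative_star_algebra) \<noteq> 0" "(J::'a) \<in> \<S>\<^sub>A"
  shows "J \<notin> \<real>\<^sub>A"
proof
  assume "J \<in> \<real>\<^sub>A"
  then obtain r where "J = emb r"
    by (auto simp: real_part_set_def)
  then have "(r * r) *\<^sub>R (1::'a) = - 1"
    using assms(2) by (simp add: imag_units_def emb_def na_simps)
  then have "(r * r + 1) *\<^sub>R (1::'a) = 0"
    by (simp add: scaleR_left_distrib)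
  moreover have "r * r + 1 \<noteq> 0"
    by (smt (verit) zero_le_square)
  ultimately show False
    using assms(1) by simp
qed

lemma imag_unit_mult_self: "J \<in> \<S>\<^sub>A \<Longrightarrow> J * J = - 1"
  by (simp add: imag_units_def)

text \<open>Multiplying \<open>J\<^sup>c = t - J\<close> by \<open>J\<close> gives
  \<open>n = t J + 1\<close>, so a non-zero trace \<open>t\<close> would make \<open>J\<close>
  real.\<close>

lemma star_imag_unit:
  assumes one: "(1::'a::real_alternative_star_algebra) \<noteq> 0" and J: "(J::'a) \<in> \<S>\<^sub>A"
  shows "J\<^sup>c = - J"
proof -
  have "J \<notin> \<real>\<^sub>A"
    using imag_unit_not_real[OF assms] .
  with J obtain t n where t: "J + J\<^sup>c = emb t" and n: "J * J\<^sup>c = emb n"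
    by (auto simp: imag_units_def quadratic_cone_def trace_el_def norm_el_def)
  from t have Jc: "J\<^sup>c = emb t - J"
    by (simp add: algebra_simps)
  have "t *\<^sub>R J = emb (n - 1)"
    using n imag_unit_mult_self[OF J]
    by (simp add: Jc na_simps emb_def algebra_simps)
  have "t = 0"
  proof (rule ccontr)
    assume "t \<noteq> 0"
    then have "J = (1 / t) *\<^sub>R (t *\<^sub>R J)"
      by simp
    also have "\<dots> = emb ((n - 1) / t)"
      by (simp only: \<open>t *\<^sub>R J = emb (n - 1)\<close>) (simp add: emb_def)
    finally show False
      using \<open>J \<notin> \<real>\<^sub>A\<close> emb_in_reals by metis
  qed
  then show ?thesis
    by (simp add: Jc emb_def)
qed

text \<open>Such an \<open>I\<close> has trace 0 and norm 1. With \<open>star_imag_unit\<close> this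
  describes the units by two equations, without the quadratic cone.\<close>

lemma imag_unitI:
  assumes "(I::'a::real_alternative_star_algebra)\<^sup>c = - I" "I * I = - 1"
  shows "I \<in> \<S>\<^sub>A"
proof -
  have "trace_el I = emb 0" "norm_el I = emb 1" "4 * (1::real) > 0\<^sup>2"
    using assms by (simp_all add: trace_el_def norm_el_def emb_def na_simps)
  then show ?thesis
    unfolding imag_units_def quadratic_cone_def using assms(2) by blast
qed

lemma uminus_imag_unit:
  assumes "(1::'a::real_alternative_star_algebra) \<noteq> 0" "(J::'a) \<in> \<S>\<^sub>A"
  shows "- J \<in> \<S>\<^sub>A"
  using assms by (intro imag_unitI) (simp_all add: star_imag_unit star_minus imag_unit_mult_self na_simps)

lemma not_real_plus_imag_unit:
  assumes "(1::'a::real_alternative_star_algebra) \<noteq> 0" "(J::'a) \<in> \<S>\<^sub>A" "\<beta> \<noteq> 0"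
  shows "emb \<alpha> + \<beta> *\<^sub>R J \<notin> \<real>\<^sub>A"
proof
  assume "emb \<alpha> + \<beta> *\<^sub>R J \<in> \<real>\<^sub>A"
  then obtain r where "emb \<alpha> + \<beta> *\<^sub>R J = emb r"
    by (auto simp: real_part_set_def)
  then have "\<beta> *\<^sub>R J = emb (r - \<alpha>)"
    by (simp add: emb_def algebra_simps)
  then have "J = (1 / \<beta>) *\<^sub>R emb (r - \<alpha>)"
    using assms(3)
    by (metis scaleR_scaleR divide_self_if mult.commute times_divide_eq_right mult.right_neutral scaleR_one)
  also have "\<dots> = emb ((r - \<alpha>) / \<beta>)"
    by (simp add: emb_def)
  finally show False
    using imag_unit_not_real[OF assms(1,2)] by simp
qed

text \<open>\<open>sphere_of\<close> ranges over all decompositions of the point. Adding the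
  conjugate recovers \<alpha>, since conjugation negates units; squaring recovers \<beta> up to
  sign, and the sign is absorbed by passing from \<open>I\<close> to \<open>- I\<close>.\<close>

lemma sphere_of_eq:
  assumes one: "(1::'a::real_alternative_star_algebra) \<noteq> 0" and J: "(J::'a) \<in> \<S>\<^sub>A"
  shows "\<S>\<^bsub>emb \<alpha> + \<beta> *\<^sub>R J\<^esub> = (\<lambda>I. emb \<alpha> + \<beta> *\<^sub>R I) ` \<S>\<^sub>A"
proof
  show "(\<lambda>I. emb \<alpha> + \<beta> *\<^sub>R I) ` \<S>\<^sub>A \<subseteq> \<S>\<^bsub>emb \<alpha> + \<beta> *\<^sub>R J\<^esub>"
    using J unfolding sphere_of_def by blast
  show "\<S>\<^bsub>emb \<alpha> + \<beta> *\<^sub>R J\<^esub> \<subseteq> (\<lambda>I. emb \<alpha> + \<beta> *\<^sub>R I) ` \<S>\<^sub>A"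
  proof
    fix y assume "y \<in> \<S>\<^bsub>emb \<alpha> + \<beta> *\<^sub>R J\<^esub>"
    then obtain \<alpha>' \<beta>' I K where y: "y = emb \<alpha>' + \<beta>' *\<^sub>R I" and I: "I \<in> \<S>\<^sub>A"
      and K: "K \<in> \<S>\<^sub>A" and eq: "emb \<alpha> + \<beta> *\<^sub>R J = emb \<alpha>' + \<beta>' *\<^sub>R K"
      unfolding sphere_of_def by blast
    have "emb \<alpha> - \<beta> *\<^sub>R J = emb \<alpha>' - \<beta>' *\<^sub>R K"
      using arg_cong[OF eq, of star]
      by (simp add: star_add star_scaleR star_imag_unit[OF one] J K)
    from arg_cong2[OF eq this, of "(+)"] have "2 *\<^sub>R emb \<alpha> = (2 *\<^sub>R emb \<alpha>' :: 'a)"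
      by (simp add: scaleR_2)
    then have a: "\<alpha>' = \<alpha>"
      using one by (simp add: emb_def)
    with eq have "\<beta> *\<^sub>R J = \<beta>' *\<^sub>R K"
      by simp
    then have "(\<beta> *\<^sub>R J) * (\<beta> *\<^sub>R J) = (\<beta>' *\<^sub>R K) * (\<beta>' *\<^sub>R K)"
      by simp
    then have "\<beta> * \<beta> = \<beta>' * \<beta>'"
      using one by (simp add: na_simps imag_unit_mult_self J K)
    then have "\<beta>' = \<beta> \<or> \<beta>' = - \<beta>"
      by (metis square_eq_iff)
    then show "y \<in> (\<lambda>I. emb \<alpha> + \<beta> *\<^sub>R I) ` \<S>\<^sub>A"
    proof
      assume "\<beta>' = \<beta>"
      with y a I show ?thesis by blast
    next
      assume "\<beta>' = - \<beta>"
      with y a have "y = emb \<alpha> + \<beta> *\<^sub>R (- I)" by simp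
      with uminus_imag_unit[OF one I] show ?thesis by blast
    qed
  qed
qed

section \<open>Slice functions on a sphere\<close>

text \<open>The conjugate point carries the unit \<open>- J\<close>, so the values differ by
  \<open>2 (J b)\<close>. The inverse of \<open>\<beta> J\<close> is \<open>- J / \<beta>\<close>,
  and left alternativity gives \<open>J * (J * b) = - b\<close>.\<close>

lemma spherical_derivative_eq:
  assumes one: "(1::'a::real_alternative_star_algebra) \<noteq> 0"
    and f: "induced_slice_function D F f"
    and z: "Complex \<alpha> \<beta> \<in> D" and J: "(J::'a) \<in> \<S>\<^sub>A" and "\<beta> \<noteq> 0"
  shows "\<partial>\<^sub>s f (emb \<alpha> + \<beta> *\<^sub>R J) = (1 / \<beta>) *\<^sub>R snd (F (Complex \<alpha> \<beta>))"
proof -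
  let ?x = "emb \<alpha> + \<beta> *\<^sub>R J" and ?b = "snd (F (Complex \<alpha> \<beta>))"
  have JJ: "J * J = - 1"
    using imag_unit_mult_self[OF J] .
  have xc: "?x\<^sup>c = emb \<alpha> + \<beta> *\<^sub>R (- J)"
    by (simp add: star_add star_scaleR star_imag_unit[OF one J])
  have "im_part ?x = (1 / 2) *\<^sub>R (2 *\<^sub>R (\<beta> *\<^sub>R J))"
    unfolding im_part_def xc by (simp add: scaleR_2 del: scaleR_scaleR)
  then have "alg_inverse (im_part ?x) = (- 1 / \<beta>) *\<^sub>R J"
    using \<open>\<beta> \<noteq> 0\<close> by (intro alg_inverse_eq) (simp_all add: na_simps JJ)
  moreover have "f ?x - f (?x\<^sup>c) = 2 *\<^sub>R (J * ?b)"
    using f z J uminus_imag_unit[OF one J] unfolding xc induced_slice_function_def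
    by (simp add: na_simps scaleR_2 del: scaleR_minus_right)
  ultimately show ?thesis
    by (simp add: spherical_derivative_def na_simps left_alternative JJ)
qed

section \<open>Imaginary units solving \<open>a + I * b = 0\<close>\<close>

text \<open>Right multiplication by \<open>b\<^sup>c\<close> turns \<open>I * b\<close> into
  \<open>r I\<close>.\<close>

lemma imag_unit_root_unique:
  assumes "b * b\<^sup>c = emb r" "b\<^sup>c * b = emb r" "r \<noteq> 0"
    and "a + I * b = 0" "a + I' * b = 0"
  shows "I = (I'::'a::real_alternative_star_algebra)"
proof -
  have "I * b = I' * b"
    using assms(4,5) by (metis add_left_cancel)
  then have "r *\<^sub>R I = r *\<^sub>R I'"
    using mult_mult_emb[OF assms(1-3)] by metis
  then show ?thesis
    using assms(3) by simp
qed

text \<open>Middle Moufang puts the real \<open>b * b\<^sup>c\<close> between two factors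
  \<open>I\<close>. Only skewness of \<open>I\<close> is assumed, so that a known norm can later
  force \<open>I * I = - 1\<close>.\<close>

lemma norm_el_imag_mult:
  assumes "b * b\<^sup>c = emb r" and "(I::'a::real_alternative_star_algebra)\<^sup>c = - I"
  shows "norm_el (I * b) = - (r *\<^sub>R (I * I))"
  by (simp add: norm_el_def star_mult assms na_simps middle_moufang emb_def)

lemma imag_unit_root_iff:
  fixes a b :: "'a::real_alternative_star_algebra"
  assumes one: "(1::'a) \<noteq> 0"
    and b: "b * b\<^sup>c = emb r" "b\<^sup>c * b = emb r" "r \<noteq> 0"
  shows "(\<exists>I\<in>\<S>\<^sub>A. a + I * b = 0) \<longleftrightarrow> (a, b) *\<^sub>C cstar (a, b) = 0"
proof
  assume "\<exists>I\<in>\<S>\<^sub>A. a + I * b = 0"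
  then obtain I where I: "I \<in> \<S>\<^sub>A" and "a + I * b = 0" by blast
  then have a: "a = - (I * b)"
    by (simp add: eq_neg_iff_add_eq_0)
  have Ic: "I\<^sup>c = - I"
    using star_imag_unit[OF one I] .
  have "norm_el (I * b) = emb r"
    using norm_el_imag_mult[OF b(1) Ic] imag_unit_mult_self[OF I] by (simp add: emb_def)
  then have "a * a\<^sup>c - b * b\<^sup>c = 0"
    by (simp add: a norm_el_def star_minus na_simps b)
  moreover have 1: "(I * b) * b\<^sup>c = r *\<^sub>R I"
    using mult_mult_emb[OF b] .
  \<comment> \<open>Conjugation supplies the mirror image of the preceding identity, with the
    product taken from the left.\<close>
  have "b * (b\<^sup>c * I) = r *\<^sub>R I"
    using arg_cong[OF 1, of star] by (simp add: star_mult star_star star_scaleR Ic na_simps)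
  with 1 have "a * b\<^sup>c + b * a\<^sup>c = 0"
    by (simp add: a star_minus star_mult Ic na_simps)
  ultimately show "(a, b) *\<^sub>C cstar (a, b) = 0"
    by (simp add: cmul_def cstar_def zero_prod_def)
next
  assume "(a, b) *\<^sub>C cstar (a, b) = 0"
  then have n: "norm_el a = emb r" and t: "b * a\<^sup>c = - (a * b\<^sup>c)"
    by (simp_all add: cmul_def cstar_def zero_prod_def norm_el_def b eq_neg_iff_add_eq_0 add.commute)
  \<comment> \<open>Right multiplication of \<open>a + I * b = 0\<close> by \<open>b\<^sup>c\<close>
    gives \<open>a * b\<^sup>c + r I = 0\<close>.\<close>
  define I where "I = (- 1 / r) *\<^sub>R (a * b\<^sup>c)"
  have Ib: "I * b = - a"
    using mult_mult_emb[of "b\<^sup>c" b r a] b by (simp add: I_def na_simps)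
  \<comment> \<open>The conjugate of \<open>a * b\<^sup>c\<close> is \<open>b * a\<^sup>c\<close>,
    so the second component of the product says that \<open>I\<close> is skew.\<close>
  have Ic: "I\<^sup>c = - I"
    by (simp add: I_def star_minus star_scaleR star_mult star_star t)
  \<comment> \<open>Both sides are the norm of \<open>I * b = - a\<close>.\<close>
  have "- (r *\<^sub>R (I * I)) = emb r"
    using norm_el_imag_mult[OF b(1) Ic] n by (simp add: Ib norm_el_def star_minus na_simps)
  then have "r *\<^sub>R (I * I) = r *\<^sub>R (- 1)"
    by (simp add: emb_def minus_equation_iff)
  then have "I * I = - 1"
    using b(3) by (simp only: scaleR_cancel_left) simp
  with Ic have "I \<in> \<S>\<^sub>A"
    by (rule imag_unitI)
  with Ib show "\<exists>I\<in>\<S>\<^sub>A. a + I * b = 0"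
    by (intro bexI[of _ I]) simp_all
qed

text \<open>The annihilating factor is \<open>cstar (F z)\<close>, non-zero because conjugation is
  injective.\<close>

lemma zero_divisor_if_CN_eq_0:
  assumes "F z \<noteq> 0" "CN F z = 0"
  shows "zero_divisor (F z)"
proof -
  have "cstar (F z) \<noteq> 0"
    using assms(1) by (cases "F z") (auto simp: cstar_def zero_prod_def)
  with assms show ?thesis
    unfolding zero_divisor_def CN_def by blast
qed

section \<open>Classification of the zeros on a sphere\<close>

text \<open>\<open>isotropic_constant_at\<close> isolates the one situation in which
  \<open>CN F z\<close> vanishes without a zero on the sphere.\<close>

theorem theorem17:
  fixes F :: "complex \<Rightarrow> 'a::real_alternative_star_algebra complexified"
    and f :: "'a \<Rightarrow> 'a"
    and D :: "complex set"
    and \<alpha> \<beta> :: real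
    and J x :: 'a
    and z :: complex
  assumes finite_dim: "\<exists>B :: 'a set. finite B \<and> span B = UNIV"
    and dim_gt_1: "dim (UNIV :: 'a set) > 1"
    and S_nonempty: "(\<S>\<^sub>A :: 'a set) \<noteq> {}"
    and D: "open D" "\<forall>w\<in>D. cnj w \<in> D"
    and F: "stem_function D F"
    and f: "induced_slice_function D F f"
    and J: "J \<in> \<S>\<^sub>A"
    and z: "z = Complex \<alpha> \<beta>" "z \<in> D"
    and x: "x = emb \<alpha> + \<beta> *\<^sub>R J"
    and ds: "x \<notin> \<real>\<^sub>A \<longrightarrow> \<partial>\<^sub>s f x \<in> N\<^sub>A"
  shows
    "let case1 = (\<S>\<^bsub>x\<^esub> \<inter> zero_set D f = {});
         case2 = (\<S>\<^bsub>x\<^esub> \<subseteq> zero_set D f);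
         case3 = (\<exists>y. \<S>\<^bsub>x\<^esub> \<inter> zero_set D f = {y} \<and> y \<notin> \<real>\<^sub>A);
         case1' = (CN F z \<noteq> 0);
         case2' = (F z = 0);
         case3' = (F z \<noteq> 0 \<and> CN F z = 0)
     in (case1 \<or> case2 \<or> case3)
        \<and> \<not> (case1 \<and> case2) \<and> \<not> (case1 \<and> case3) \<and> \<not> (case2 \<and> case3)
        \<and> (\<not> isotropic_constant_at f x \<longrightarrow>
              (case1 \<longleftrightarrow> case1') \<and> (case2 \<longleftrightarrow> case2') \<and> (case3 \<longleftrightarrow> case3'))
        \<and> (isotropic_constant_at f x \<longrightarrow> case1 \<and> case3')
        \<and> (case3' \<longrightarrow> zero_divisor (F z))"
proof -
  have one: "(1::'a) \<noteq> 0"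
    using one_neq_zero[OF dim_gt_1] .
  obtain a b where Fz: "F z = (a, b)"
    by (cases "F z")
  define p where "p I = emb \<alpha> + \<beta> *\<^sub>R I" for I :: 'a
  have sphere: "\<S>\<^bsub>x\<^esub> = p ` \<S>\<^sub>A"
    unfolding x p_def by (rule sphere_of_eq[OF one J])
  have fp: "f (p I) = a + I * b" if "I \<in> \<S>\<^sub>A" for I
    using f z that Fz by (auto simp: induced_slice_function_def p_def)
  have x_p: "x = p J"
    by (simp add: x p_def)
  \<comment> \<open>Counting zeros becomes counting roots \<open>I\<close> of
    \<open>a + I * b = 0\<close>, up to the parametrization \<open>p\<close>, which is constant when
    \<beta> = 0.\<close>
  have zeros: "\<S>\<^bsub>x\<^esub> \<inter> zero_set D f = p ` {I \<in> \<S>\<^sub>A. a + I * b = 0}"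
  proof -
    have "p I \<in> \<Omega>\<^bsub>D\<^esub>" if "I \<in> \<S>\<^sub>A" for I
      using z that unfolding slice_domain_def p_def by blast
    then show ?thesis
      unfolding sphere zero_set_def using fp by auto
  qed
  have CN: "CN F z = (a, b) *\<^sub>C cstar (a, b)"
    by (simp add: CN_def Fz)
  have ne: "\<S>\<^bsub>x\<^esub> \<noteq> {}"
    using J by (auto simp: sphere)
  \<comment> \<open>Antipodal points differ, so the sphere of a non-real point is never a
    singleton.\<close>
  have inj: "p I \<noteq> p (- I)" if "I \<in> \<S>\<^sub>A" "\<beta> \<noteq> 0" for I
  proof
    assume "p I = p (- I)"
    then have "I = - I"
      using that by (simp only: p_def add_left_cancel scaleR_cancel_left) simp
    then have "2 *\<^sub>R I = 0"
      by (metis scaleR_2 add.right_inverse)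
    then show False
      using imag_unit_mult_self[OF that(1)] one by simp
  qed
  have nonreal: "p I \<notin> \<real>\<^sub>A" if "I \<in> \<S>\<^sub>A" "\<beta> \<noteq> 0" for I
    unfolding p_def using not_real_plus_imag_unit[OF one that] .
  have x_real: "x \<in> \<real>\<^sub>A \<longleftrightarrow> \<beta> = 0"
    using nonreal[OF J] by (auto simp: x_p) (simp add: p_def)
  have deriv: "\<partial>\<^sub>s f x = (1 / \<beta>) *\<^sub>R b" if "\<beta> \<noteq> 0"
    using spherical_derivative_eq[OF one f _ J that] z Fz by (simp add: x)
  \<comment> \<open>A real \<open>z\<close> is its own conjugate, so the stem symmetry gives
    \<open>b = - b\<close>.\<close>
  have b_real: "b = 0" if "\<beta> = 0"
  proof -
    have "F z = cbar (F z)"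
      using F z that by (metis stem_function_def complex_cnj complex_eq_iff complex.sel minus_zero)
    then have "b = - b"
      by (simp add: Fz cbar_def)
    then have "2 *\<^sub>R b = 0"
      by (metis scaleR_2 add.right_inverse)
    then show ?thesis by simp
  qed
  show ?thesis
  proof (cases "b = 0")
    case True
    \<comment> \<open>Either \<beta> = 0 and \<open>x\<close> is real, or the spherical derivative
      \<open>b / \<beta>\<close> is 0; the first conjunct of the predicate holds both ways.\<close>
    have iso: "isotropic_constant_at f x \<longleftrightarrow> a \<noteq> 0 \<and> norm_el a = 0"
      using True deriv x_real fp[OF J] by (auto simp: isotropic_constant_at_def x_p)
    have CN0: "CN F z = 0 \<longleftrightarrow> norm_el a = 0"
      by (simp add: CN True cmul_def cstar_def norm_el_def zero_prod_def)
    have F0: "F z = 0 \<longleftrightarrow> a = 0"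
      by (simp add: Fz True zero_prod_def)
    have zeros': "\<S>\<^bsub>x\<^esub> \<inter> zero_set D f = (if a = 0 then \<S>\<^bsub>x\<^esub> else {})"
      using zeros by (simp add: True sphere)
    have case1: "\<S>\<^bsub>x\<^esub> \<inter> zero_set D f = {} \<longleftrightarrow> a \<noteq> 0"
      using zeros' ne by simp
    have case2: "\<S>\<^bsub>x\<^esub> \<subseteq> zero_set D f \<longleftrightarrow> a = 0"
      using zeros' ne by (auto split: if_splits)
    \<comment> \<open>A one-point sphere forces \<open>p J = p (- J)\<close>, hence \<beta> = 0 and
      the point is real.\<close>
    have case3: "\<not> (\<exists>y. \<S>\<^bsub>x\<^esub> \<inter> zero_set D f = {y} \<and> y \<notin> \<real>\<^sub>A)"
    proof
      assume "\<exists>y. \<S>\<^bsub>x\<^esub> \<inter> zero_set D f = {y} \<and> y \<notin> \<real>\<^sub>A"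
      then obtain y where y: "\<S>\<^bsub>x\<^esub> = {y}" "y \<notin> \<real>\<^sub>A"
        using zeros' by (auto split: if_splits)
      have "p J = y" "p (- J) = y"
        using y(1) J uminus_imag_unit[OF one J] unfolding sphere by blast+
      then show False
        using inj[OF J] y(2) by (cases "\<beta> = 0") (auto simp: p_def)
    qed
    \<comment> \<open>Makes (1') fail when \<open>a = 0\<close>.\<close>
    have "norm_el (0::'a) = 0"
      by (simp add: norm_el_def)
    then show ?thesis
      unfolding Let_def case1 case2 using case3 iso CN0 F0 zero_divisor_if_CN_eq_0[of F z] by auto
  next
    case False
    then have \<beta>: "\<beta> \<noteq> 0"
      using b_real by blast
    have not_iso: "\<not> isotropic_constant_at f x"
      using False \<beta> x_real deriv by (simp add: isotropic_constant_at_def)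
    \<comment> \<open>The derivative \<open>b / \<beta>\<close> is a non-zero element of the normal
      cone; its norm is then transferred to \<open>b\<close>, the norm being homogeneous of degree
      2.\<close>
    have N: "norm_el ((1 / \<beta>) *\<^sub>R b) = norm_el (((1 / \<beta>) *\<^sub>R b)\<^sup>c)"
      "norm_el ((1 / \<beta>) *\<^sub>R b) \<in> \<real>\<^sub>A" "norm_el ((1 / \<beta>) *\<^sub>R b) \<noteq> 0"
      using ds x_real \<beta> deriv False by (auto simp: normal_cone_def)
    then obtain s where Ns: "norm_el ((1 / \<beta>) *\<^sub>R b) = emb s"
      by (auto simp: real_part_set_def)
    have s0: "emb s \<noteq> (0::'a)"
      using N(3) unfolding Ns .
    have s: "(1 / \<beta>\<^sup>2) *\<^sub>R (b * b\<^sup>c) = emb s" "(1 / \<beta>\<^sup>2) *\<^sub>R (b\<^sup>c * b) = emb s"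
      using Ns N(1)
      by (simp_all add: norm_el_def star_scaleR star_star na_simps power2_eq_square)
    define r where "r = \<beta>\<^sup>2 * s"
    have "\<beta>\<^sup>2 *\<^sub>R ((1 / \<beta>\<^sup>2) *\<^sub>R y) = y" for y :: 'a
      using \<beta> by simp
    then have r: "b * b\<^sup>c = emb r" "b\<^sup>c * b = emb r"
      unfolding r_def emb_def scaleR_scaleR[symmetric] using s[unfolded emb_def] by metis+
    have "r \<noteq> 0"
      using s0 \<beta> by (auto simp: r_def emb_def)
    note r = r this
    let ?R = "{I \<in> \<S>\<^sub>A. a + I * b = 0}"
    have root: "?R \<noteq> {} \<longleftrightarrow> CN F z = 0"
      using imag_unit_root_iff[OF one r] unfolding CN by blast
    have unique: "I = I'" if "I \<in> ?R" "I' \<in> ?R" for I I'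
      using imag_unit_root_unique[OF r] that by blast
    have F0: "F z \<noteq> 0"
      using False by (simp add: Fz zero_prod_def)
    have case1: "\<S>\<^bsub>x\<^esub> \<inter> zero_set D f = {} \<longleftrightarrow> CN F z \<noteq> 0"
      unfolding zeros using root by blast
    \<comment> \<open>Otherwise the opposite units \<open>J\<close> and \<open>- J\<close> would
      both be roots, against uniqueness.\<close>
    have case2: "\<not> \<S>\<^bsub>x\<^esub> \<subseteq> zero_set D f"
    proof
      assume "\<S>\<^bsub>x\<^esub> \<subseteq> zero_set D f"
      then have "a + J * b = 0" "a + (- J) * b = 0"
        using fp[OF J] fp[OF uminus_imag_unit[OF one J]] J uminus_imag_unit[OF one J]
        unfolding sphere zero_set_def by auto
      then have "J = - J"
        by (rule imag_unit_root_unique[OF r])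
      then show False
        using inj[OF J \<beta>] by simp
    qed
    have case3: "(\<exists>y. \<S>\<^bsub>x\<^esub> \<inter> zero_set D f = {y} \<and> y \<notin> \<real>\<^sub>A) \<longleftrightarrow> CN F z = 0"
    proof
      assume "\<exists>y. \<S>\<^bsub>x\<^esub> \<inter> zero_set D f = {y} \<and> y \<notin> \<real>\<^sub>A"
      then show "CN F z = 0"
        using case1 by auto
    next
      assume "CN F z = 0"
      then obtain I where I: "I \<in> ?R"
        using root by blast
      then have "?R = {I}"
        using unique by blast
      then have "\<S>\<^bsub>x\<^esub> \<inter> zero_set D f = {p I}"
        unfolding zeros by simp
      then show "\<exists>y. \<S>\<^bsub>x\<^esub> \<inter> zero_set D f = {y} \<and> y \<notin> \<real>\<^sub>A"
        using nonreal I \<beta> by auto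
    qed
    show ?thesis
      unfolding Let_def case1 case3 using case2 not_iso F0 zero_divisor_if_CN_eq_0[of F z] by auto
  qed
qed

end
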